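(* Let $S$ be a simple non-trivial left brace (i.e. a simple left brace that is not a trivial brace). Let $T$ be a trivial brace and let $T\rtimes_{\circ} S$ be an asymmetric product of $T$ by $S$ via $b\colon T\times T\to S$ and $\alpha\colon (S,\cdot)\to \operatorname{Aut}(T,+)$, $s\mapsto\alpha_s$. Suppose that for every $t\in T\setminus\{0\}$ there exists $t'\in T$ such that $b(t,t')\neq 0$. Then $T\rtimes_{\circ} S$ is simple if and only if $\sum_{s\in S}\operatorname{Im}(\alpha_s-\operatorname{id})=T$.
   Context: A left brace is a set $B$ with two operations $+$ and $\cdot$ such that $(B,+)$ is an abelian group, $(B,\cdot)$ is a group and $a\cdot(b+c)+a=a\cdot b+a\cdot c$ for all $a,b,c\in B$. The neutral elements of $(B,+)$ and $(B,\cdot)$ coincide and are denoted by $0$. The lambda map is $\lambda_a(b)=a\cdot b-a$. An ideal of $B$ is a normal subgroup $N$ of $(B,\cdot)$ such that $\lambda_b(a)\in N$ for all $b\in B$, $a\in N$. A non-zero left brace $B$ is simple if $\{0\}$ and $B$ are its only ideals. A left brace is trivial (a trivial brace) if $a\cdot b=a+b$ for all $a,b$; in this case $\operatorname{Aut}(T,+,\cdot)=\operatorname{Aut}(T,+)$. Asymmetric product: let $T$ and $S$ be left braces. A (normalized) symmetric $2$-cocycle on $(T,+)$ with values in $(S,+)$ is a map $b\colon T\times T\to S$ with $b(0,0)=0$, $b(t_1,t_2)=b(t_2,t_1)$ and $b(t_1+t_2,t_3)+b(t_1,t_2)=b(t_1,t_2+t_3)+b(t_2,t_3)$ for all $t_1,t_2,t_3\in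 T$. Let $b$ be such a cocycle and let $\alpha\colon(S,\cdot)\to\operatorname{Aut}(T,+,\cdot)$, $s\mapsto\alpha_s$, be a group homomorphism such that $$s\cdot b(t_2,t_3)+b(t_1\cdot\alpha_s(t_2+t_3),t_1)=b(t_1\cdot\alpha_s(t_2),t_1\cdot\alpha_s(t_3))+s$$ for all $s\in S$, $t_1,t_2,t_3\in T$. The asymmetric product $T\rtimes_\circ S$ of $T$ by $S$ via $b$ and $\alpha$ is the left brace on the set $T\times S$ with operations $$(t_1,s_1)+(t_2,s_2)=(t_1+t_2,\;s_1+s_2+b(t_1,t_2)),\qquad (t_1,s_1)\cdot(t_2,s_2)=(t_1\cdot\alpha_{s_1}(t_2),\;s_1\cdot s_2).$$ The sum $\sum_{s\in S}\operatorname{Im}(\alpha_s-\operatorname{id})$ denotes the subgroup of $(T,+)$ generated by the subgroups $\operatorname{Im}(\alpha_s-\operatorname{id})=\{\alpha_s(t)-t\mid t\in T\}$. *)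

theory Defs
  imports "HOL-Algebra.Ring" "HOL-Algebra.Bij" "HOL-Algebra.Generated_Groups"
begin

text \<open>
  A left brace is carried by the HOL-Algebra record type of rings: \<open>\<oplus>\<close>, \<open>\<zero>\<close> are the additive
  operation and its neutral element, \<open>\<otimes>\<close>, \<open>\<one>\<close> the multiplicative ones.  That the two neutral
  elements coincide is a consequence of the axioms, see \<open>left_brace.one_eq_zero\<close>.
\<close>

locale left_brace = abelian_group B + group B for B (structure) +
  assumes brace_distrib:
    "\<lbrakk> x \<in> carrier B; y \<in> carrier B; z \<in> carrier B \<rbrakk>
      \<Longrightarrow> x \<otimes> (y \<oplus> z) \<oplus> x = x \<otimes> y \<oplus> x \<otimes> z"

lemma (in left_brace) one_eq_zero: "\<one> = \<zero>"
proof -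
  have "\<zero> \<oplus> \<one> = \<one> \<otimes> (\<zero> \<oplus> \<zero>) \<oplus> \<one>"
    by simp
  also have "\<dots> = \<zero> \<oplus> \<zero>"
    by (subst brace_distrib) simp_all
  finally show ?thesis
    by simp
qed

definition lambda_map :: "('a, 'm) ring_scheme \<Rightarrow> 'a \<Rightarrow> 'a \<Rightarrow> 'a" where
  "lambda_map B x y = x \<otimes>\<^bsub>B\<^esub> y \<ominus>\<^bsub>B\<^esub> x"

definition brace_ideal :: "'a set \<Rightarrow> ('a, 'm) ring_scheme \<Rightarrow> bool" where
  "brace_ideal N B \<longleftrightarrow>
     N \<lhd> B \<and> (\<forall>x\<in>carrier B. \<forall>y\<in>N. lambda_map B x y \<in> N)"

definition simple_left_brace :: "('a, 'm) ring_scheme \<Rightarrow> bool" where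
  "simple_left_brace B \<longleftrightarrow>
     left_brace B \<and> carrier B \<noteq> {\<zero>\<^bsub>B\<^esub>} \<and>
     (\<forall>N. brace_ideal N B \<longrightarrow> N = {\<zero>\<^bsub>B\<^esub>} \<or> N = carrier B)"

definition trivial_brace :: "('a, 'm) ring_scheme \<Rightarrow> bool" where
  "trivial_brace B \<longleftrightarrow>
     left_brace B \<and> (\<forall>x\<in>carrier B. \<forall>y\<in>carrier B. x \<otimes>\<^bsub>B\<^esub> y = x \<oplus>\<^bsub>B\<^esub> y)"

text \<open>
  \<open>Aut(B, +, \<cdot>)\<close>, with composition as multiplication.  As everywhere in \<open>HOL-Algebra.Bij\<close>, its
  elements are extensional functions, i.e. they are \<open>undefined\<close> outside the carrier.
\<close>

definition brace_AutoGroup :: "('a, 'm) ring_scheme \<Rightarrow> ('a \<Rightarrow> 'a) monoid" where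
  "brace_AutoGroup B = BijGroup (carrier B) \<lparr> carrier := auto B \<inter> auto (add_monoid B) \<rparr>"

lemma trivial_brace_AutoGroup:
  assumes "trivial_brace T"
  shows "brace_AutoGroup T = AutoGroup (add_monoid T)"
proof -
  interpret T: left_brace T
    using assms by (simp add: trivial_brace_def)
  have "auto T = auto (add_monoid T)"
    using assms by (fastforce simp: auto_def hom_def trivial_brace_def Pi_iff)
  then show ?thesis
    by (simp add: brace_AutoGroup_def AutoGroup_def)
qed

locale symmetric_2_cocycle =
  fixes T :: "('a, 'm) ring_scheme" and S :: "('b, 'n) ring_scheme" and b :: "'a \<Rightarrow> 'a \<Rightarrow> 'b"
  assumes cocycle_closed: "b \<in> carrier T \<rightarrow> carrier T \<rightarrow> carrier S"
    and cocycle_zero: "b \<zero>\<^bsub>T\<^esub> \<zero>\<^bsub>T\<^esub> = \<zero>\<^bsub>S\<^esub>"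
    and cocycle_sym: "\<lbrakk> t1 \<in> carrier T; t2 \<in> carrier T \<rbrakk> \<Longrightarrow> b t1 t2 = b t2 t1"
    and cocycle: "\<lbrakk> t1 \<in> carrier T; t2 \<in> carrier T; t3 \<in> carrier T \<rbrakk>
      \<Longrightarrow> b (t1 \<oplus>\<^bsub>T\<^esub> t2) t3 \<oplus>\<^bsub>S\<^esub> b t1 t2 = b t1 (t2 \<oplus>\<^bsub>T\<^esub> t3) \<oplus>\<^bsub>S\<^esub> b t2 t3"

locale asymmetric_product_data =
  T: left_brace T + S: left_brace S + symmetric_2_cocycle T S b
  for T :: "('a, 'm) ring_scheme" and S :: "('b, 'n) ring_scheme" and b :: "'a \<Rightarrow> 'a \<Rightarrow> 'b" +
  fixes \<alpha> :: "'b \<Rightarrow> 'a \<Rightarrow> 'a"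
  assumes alpha_hom: "\<alpha> \<in> hom S (brace_AutoGroup T)"
    and compat: "\<lbrakk> s \<in> carrier S; t1 \<in> carrier T; t2 \<in> carrier T; t3 \<in> carrier T \<rbrakk>
      \<Longrightarrow> s \<otimes>\<^bsub>S\<^esub> b t2 t3 \<oplus>\<^bsub>S\<^esub> b (t1 \<otimes>\<^bsub>T\<^esub> \<alpha> s (t2 \<oplus>\<^bsub>T\<^esub> t3)) t1
        = b (t1 \<otimes>\<^bsub>T\<^esub> \<alpha> s t2) (t1 \<otimes>\<^bsub>T\<^esub> \<alpha> s t3) \<oplus>\<^bsub>S\<^esub> s"

definition asymmetric_product ::
  "('a, 'm) ring_scheme \<Rightarrow> ('b, 'n) ring_scheme \<Rightarrow> ('a \<Rightarrow> 'a \<Rightarrow> 'b) \<Rightarrow> ('b \<Rightarrow> 'a \<Rightarrow> 'a)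
    \<Rightarrow> ('a \<times> 'b) ring" where
  "asymmetric_product T S b \<alpha> =
    \<lparr> carrier = carrier T \<times> carrier S,
      mult = (\<lambda>(t1, s1) (t2, s2). (t1 \<otimes>\<^bsub>T\<^esub> \<alpha> s1 t2, s1 \<otimes>\<^bsub>S\<^esub> s2)),
      one = (\<one>\<^bsub>T\<^esub>, \<one>\<^bsub>S\<^esub>),
      zero = (\<zero>\<^bsub>T\<^esub>, \<zero>\<^bsub>S\<^esub>),
      add = (\<lambda>(t1, s1) (t2, s2). (t1 \<oplus>\<^bsub>T\<^esub> t2, s1 \<oplus>\<^bsub>S\<^esub> s2 \<oplus>\<^bsub>S\<^esub> b t1 t2)) \<rparr>"

context asymmetric_product_data
begin

lemma alpha_auto: "s \<in> carrier S \<Longrightarrow> \<alpha> s \<in> auto T \<inter> auto (add_monoid T)"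
  using alpha_hom by (auto simp: hom_def brace_AutoGroup_def)

lemma alpha_closed: "\<lbrakk> s \<in> carrier S; t \<in> carrier T \<rbrakk> \<Longrightarrow> \<alpha> s t \<in> carrier T"
  using alpha_auto[of s] by (auto simp: auto_def hom_def)

lemma alpha_mult: "\<lbrakk> s \<in> carrier S; t \<in> carrier T; u \<in> carrier T \<rbrakk>
    \<Longrightarrow> \<alpha> s (t \<otimes>\<^bsub>T\<^esub> u) = \<alpha> s t \<otimes>\<^bsub>T\<^esub> \<alpha> s u"
  using alpha_auto[of s] by (auto simp: auto_def hom_def)

lemma alpha_add: "\<lbrakk> s \<in> carrier S; t \<in> carrier T; u \<in> carrier T \<rbrakk>
    \<Longrightarrow> \<alpha> s (t \<oplus>\<^bsub>T\<^esub> u) = \<alpha> s t \<oplus>\<^bsub>T\<^esub> \<alpha> s u"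
  using alpha_auto[of s] by (auto simp: auto_def hom_def)

lemma alpha_comp:
  assumes "s \<in> carrier S" "r \<in> carrier S" "t \<in> carrier T"
  shows "\<alpha> (s \<otimes>\<^bsub>S\<^esub> r) t = \<alpha> s (\<alpha> r t)"
proof -
  have "\<alpha> s \<in> Bij (carrier T)" "\<alpha> r \<in> Bij (carrier T)"
    using alpha_auto assms by (auto simp: auto_def)
  moreover have "\<alpha> (s \<otimes>\<^bsub>S\<^esub> r) = \<alpha> s \<otimes>\<^bsub>brace_AutoGroup T\<^esub> \<alpha> r"
    using alpha_hom assms by (simp add: hom_def)
  ultimately show ?thesis
    using assms by (simp add: brace_AutoGroup_def BijGroup_def compose_def)
qed

lemma alpha_one:
  assumes "t \<in> carrier T"
  shows "\<alpha> \<one>\<^bsub>S\<^esub> t = t"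
proof -
  have "\<alpha> \<one>\<^bsub>S\<^esub> (\<alpha> \<one>\<^bsub>S\<^esub> t) = \<alpha> \<one>\<^bsub>S\<^esub> t"
    using alpha_comp[of "\<one>\<^bsub>S\<^esub>" "\<one>\<^bsub>S\<^esub>" t] assms by simp
  moreover have "inj_on (\<alpha> \<one>\<^bsub>S\<^esub>) (carrier T)"
    using alpha_auto[of "\<one>\<^bsub>S\<^esub>"] by (auto simp: auto_def Bij_def bij_betw_def)
  ultimately show ?thesis
    using assms alpha_closed by (auto dest: inj_onD)
qed

lemma b_closed: "\<lbrakk> t \<in> carrier T; u \<in> carrier T \<rbrakk> \<Longrightarrow> b t u \<in> carrier S"
  using cocycle_closed by blast

lemma b_zero_left:
  assumes "t \<in> carrier T"
  shows "b \<zero>\<^bsub>T\<^esub> t = \<zero>\<^bsub>S\<^esub>"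
  using cocycle[of "\<zero>\<^bsub>T\<^esub>" "\<zero>\<^bsub>T\<^esub>" t] assms b_closed cocycle_zero by simp

text \<open>The asymmetric product is a left brace.\<close>

lemma abelian_group_asymmetric_product: "abelian_group (asymmetric_product T S b \<alpha>)"
proof (rule abelian_groupI, goal_cases)
  case (3 x y z)
  then show ?case
    using cocycle[of "fst x" "fst y" "fst z"] b_closed
    by (auto simp: asymmetric_product_def T.a_assoc S.a_ac)
next
  case (4 x y)
  then show ?case
    using cocycle_sym[of "fst x" "fst y"] by (auto simp: asymmetric_product_def T.a_comm S.a_comm)
next
  case (6 x)
  then obtain t s where x: "x = (t, s)" "t \<in> carrier T" "s \<in> carrier S"
    by (auto simp: asymmetric_product_def)
  let ?c = "b (\<ominus>\<^bsub>T\<^esub> t) t"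
  have "\<ominus>\<^bsub>S\<^esub> (s \<oplus>\<^bsub>S\<^esub> ?c) \<oplus>\<^bsub>S\<^esub> s \<oplus>\<^bsub>S\<^esub> ?c = \<zero>\<^bsub>S\<^esub>"
    using x b_closed by (simp add: S.a_assoc S.l_neg)
  then show ?case
    using x b_closed
    by (intro bexI[of _ "(\<ominus>\<^bsub>T\<^esub> t, \<ominus>\<^bsub>S\<^esub> (s \<oplus>\<^bsub>S\<^esub> ?c))"])
      (auto simp: asymmetric_product_def T.l_neg)
qed (auto simp: asymmetric_product_def b_closed b_zero_left)

lemma group_asymmetric_product: "group (asymmetric_product T S b \<alpha>)"
proof (rule groupI, goal_cases)
  case (3 x y z)
  then show ?case
    by (auto simp: asymmetric_product_def T.m_assoc S.m_assoc alpha_mult alpha_closed alpha_comp)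
next
  case (5 x)
  then obtain t s where x: "x = (t, s)" "t \<in> carrier T" "s \<in> carrier S"
    by (auto simp: asymmetric_product_def)
  let ?r = "inv\<^bsub>S\<^esub> s"
  have "\<alpha> ?r t \<in> carrier T"
    using x alpha_closed by simp
  then show ?case
    using x by (intro bexI[of _ "(inv\<^bsub>T\<^esub> (\<alpha> ?r t), ?r)"]) (auto simp: asymmetric_product_def)
qed (auto simp: asymmetric_product_def alpha_closed alpha_one)

theorem left_brace_asymmetric_product: "left_brace (asymmetric_product T S b \<alpha>)"
proof (intro left_brace.intro left_brace_axioms.intro abelian_group_asymmetric_product
    group_asymmetric_product, goal_cases)
  case (1 x y z)
  then obtain t1 s1 t2 s2 t3 s3 where
    x: "x = (t1, s1)" "t1 \<in> carrier T" "s1 \<in> carrier S" and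
    y: "y = (t2, s2)" "t2 \<in> carrier T" "s2 \<in> carrier S" and
    z: "z = (t3, s3)" "t3 \<in> carrier T" "s3 \<in> carrier S"
    by (auto simp: asymmetric_product_def)
  note cl = x(2,3) y(2,3) z(2,3) b_closed alpha_closed
  let ?b = "b t2 t3"
  let ?l = "b (t1 \<otimes>\<^bsub>T\<^esub> \<alpha> s1 (t2 \<oplus>\<^bsub>T\<^esub> t3)) t1"
  let ?r = "b (t1 \<otimes>\<^bsub>T\<^esub> \<alpha> s1 t2) (t1 \<otimes>\<^bsub>T\<^esub> \<alpha> s1 t3)"
  have dist: "s1 \<otimes>\<^bsub>S\<^esub> (s2 \<oplus>\<^bsub>S\<^esub> s3 \<oplus>\<^bsub>S\<^esub> ?b) \<oplus>\<^bsub>S\<^esub> s1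
      = s1 \<otimes>\<^bsub>S\<^esub> (s2 \<oplus>\<^bsub>S\<^esub> s3) \<oplus>\<^bsub>S\<^esub> s1 \<otimes>\<^bsub>S\<^esub> ?b"
    using cl by (intro S.brace_distrib) simp_all
  have "s1 \<otimes>\<^bsub>S\<^esub> (s2 \<oplus>\<^bsub>S\<^esub> s3 \<oplus>\<^bsub>S\<^esub> ?b) \<oplus>\<^bsub>S\<^esub> s1 \<oplus>\<^bsub>S\<^esub> ?l
      = s1 \<otimes>\<^bsub>S\<^esub> (s2 \<oplus>\<^bsub>S\<^esub> s3) \<oplus>\<^bsub>S\<^esub> (s1 \<otimes>\<^bsub>S\<^esub> ?b \<oplus>\<^bsub>S\<^esub> ?l)"
    unfolding dist using cl by (simp add: S.a_assoc)
  also have "\<dots> = (s1 \<otimes>\<^bsub>S\<^esub> (s2 \<oplus>\<^bsub>S\<^esub> s3) \<oplus>\<^bsub>S\<^esub> s1) \<oplus>\<^bsub>S\<^esub> ?r"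
    using cl by (simp add: compat S.a_ac)
  also have "\<dots> = s1 \<otimes>\<^bsub>S\<^esub> s2 \<oplus>\<^bsub>S\<^esub> s1 \<otimes>\<^bsub>S\<^esub> s3 \<oplus>\<^bsub>S\<^esub> ?r"
    using cl by (simp add: S.brace_distrib)
  finally show ?case
    using cl x(1) y(1) z(1) by (simp add: asymmetric_product_def alpha_add T.brace_distrib)
qed

end

end

theory Submission
  imports Defs
begin

text \<open>
  Write \<open>P\<close> for the asymmetric product and \<open>W\<close> for the subgroup of \<open>(T, +)\<close> generated by all
  \<open>\<alpha>\<^sub>s(t) - t\<close>.  Since \<open>T\<close> is trivial, \<open>(P, \<cdot>)\<close> is the semidirect product of \<open>(T, +)\<close> by \<open>(S, \<cdot>)\<close>,
  and \<open>\<lambda>\<close> is given by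
  \<open>\<lambda>\<^bsub>(t\<^sub>1, s\<^sub>1)\<^esub>(t\<^sub>2, s\<^sub>2) = (\<alpha>\<^bsub>s\<^sub>1\<^esub>(t\<^sub>2), \<lambda>\<^bsub>s\<^sub>1\<^esub>(s\<^sub>2) - b(t\<^sub>1, \<alpha>\<^bsub>s\<^sub>1\<^esub>(t\<^sub>2)))\<close>
  (\<open>lambda_map_product\<close>).

  The group \<open>T/W\<close> is the largest quotient of \<open>T\<close> on which \<open>S\<close> acts trivially, so \<open>(t, s) \<mapsto> t + W\<close> is a
  homomorphism for both operations of \<open>P\<close>.  Its kernel \<open>W \<times> S\<close> is an ideal
  (\<open>brace_ideal_displacement_times\<close>), non-zero because \<open>S\<close> is, so simplicity of \<open>P\<close> forces \<open>W = T\<close>.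

  Conversely, let \<open>I\<close> be a non-zero ideal of \<open>P\<close>.  Its intersection with the copy \<open>{0} \<times> S\<close> of \<open>S\<close> is an
  ideal of \<open>S\<close> (\<open>brace_ideal_fibre\<close>), hence zero or everything.  It is not zero: if \<open>(t, s) \<in> I\<close> with
  \<open>t \<noteq> 0\<close>, then \<open>\<lambda>\<^bsub>(t', 0)\<^esub>(t, s) = (t, s - b(t', t))\<close> also lies in \<open>I\<close>, and for \<open>b(t, t') \<noteq> 0\<close> the quotient of
  these two elements is a non-zero element of \<open>{0} \<times> S\<close> (\<open>fibre_nonzero\<close>).  So \<open>{0} \<times> S \<subseteq> I\<close>.  The
  commutators of \<open>T \<times> {0}\<close> with \<open>{0} \<times> S\<close> then put \<open>W \<times> {0}\<close> into \<open>I\<close>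
  (\<open>displacement_in_normal\<close>), and \<open>W = T\<close> gives \<open>I = P\<close>.
\<close>

lemma brace_ideal_subset: "brace_ideal N B \<Longrightarrow> N \<subseteq> carrier B"
  by (simp add: brace_ideal_def normal_imp_subgroup subgroup.subset)

lemma (in left_brace) lambda_map_eqI:
  assumes "x \<in> carrier B" "z \<in> carrier B" "x \<otimes> y = z \<oplus> x"
  shows "lambda_map B x y = z"
  using assms by (simp add: lambda_map_def a_minus_def a_assoc r_neg)

locale asymmetric_product_by_trivial = asymmetric_product_data T S b \<alpha>
  for T :: "('a, 'm) ring_scheme" and S :: "('b, 'n) ring_scheme" and b \<alpha> +
  assumes T_mult: "\<lbrakk> x \<in> carrier T; y \<in> carrier T \<rbrakk> \<Longrightarrow> x \<otimes>\<^bsub>T\<^esub> y = x \<oplus>\<^bsub>T\<^esub> y"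
begin

abbreviation P :: "('a \<times> 'b) ring" where
  "P \<equiv> asymmetric_product T S b \<alpha>"

abbreviation displacements :: "'a set" where
  "displacements \<equiv> \<Union>s \<in> carrier S. {\<alpha> s t \<ominus>\<^bsub>T\<^esub> t | t. t \<in> carrier T}"

abbreviation W :: "'a set" where
  "W \<equiv> generate (add_monoid T) displacements"

sublocale P: left_brace P
  by (rule left_brace_asymmetric_product)

lemma carrier_P: "carrier P = carrier T \<times> carrier S"
  and zero_P: "\<zero>\<^bsub>P\<^esub> = (\<zero>\<^bsub>T\<^esub>, \<zero>\<^bsub>S\<^esub>)"
  and one_P: "\<one>\<^bsub>P\<^esub> = (\<zero>\<^bsub>T\<^esub>, \<one>\<^bsub>S\<^esub>)"
  and add_P: "(t, s) \<oplus>\<^bsub>P\<^esub> (u, r) = (t \<oplus>\<^bsub>T\<^esub> u, s \<oplus>\<^bsub>S\<^esub> r \<oplus>\<^bsub>S\<^esub> b t u)"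
  by (simp_all add: asymmetric_product_def T.one_eq_zero)

lemma mult_P:
  "\<lbrakk> t \<in> carrier T; s \<in> carrier S; u \<in> carrier T \<rbrakk>
    \<Longrightarrow> (t, s) \<otimes>\<^bsub>P\<^esub> (u, r) = (t \<oplus>\<^bsub>T\<^esub> \<alpha> s u, s \<otimes>\<^bsub>S\<^esub> r)"
  by (simp add: asymmetric_product_def T_mult alpha_closed)

lemma alpha_zero: "s \<in> carrier S \<Longrightarrow> \<alpha> s \<zero>\<^bsub>T\<^esub> = \<zero>\<^bsub>T\<^esub>"
  using alpha_add[of s "\<zero>\<^bsub>T\<^esub>" "\<zero>\<^bsub>T\<^esub>"] alpha_closed[of s "\<zero>\<^bsub>T\<^esub>"] by simp

lemma alpha_neg:
  assumes "s \<in> carrier S" "t \<in> carrier T"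
  shows "\<alpha> s (\<ominus>\<^bsub>T\<^esub> t) = \<ominus>\<^bsub>T\<^esub> \<alpha> s t"
proof -
  have "\<alpha> s (\<ominus>\<^bsub>T\<^esub> t) \<oplus>\<^bsub>T\<^esub> \<alpha> s t = \<zero>\<^bsub>T\<^esub>"
    using assms alpha_add[of s "\<ominus>\<^bsub>T\<^esub> t" t] by (simp add: T.l_neg alpha_zero)
  then show ?thesis
    using assms alpha_closed by (simp add: T.minus_equality)
qed

lemma inv_P:
  assumes "t \<in> carrier T" "s \<in> carrier S"
  shows "inv\<^bsub>P\<^esub> (t, s) = (\<ominus>\<^bsub>T\<^esub> \<alpha> (inv\<^bsub>S\<^esub> s) t, inv\<^bsub>S\<^esub> s)"
  using assms
  by (intro P.inv_equality)
    (simp_all add: mult_P one_P carrier_P alpha_closed T.l_neg)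

text \<open>
  Adding \<open>(t, s)\<close> to the right-hand side introduces exactly the value of \<open>b\<close> that is subtracted there,
  up to the order of its two arguments, so the symmetry of \<open>b\<close> cancels them.
\<close>

lemma lambda_map_product:
  assumes "t \<in> carrier T" "s \<in> carrier S" "u \<in> carrier T" "r \<in> carrier S"
  shows "lambda_map P (t, s) (u, r) = (\<alpha> s u, lambda_map S s r \<ominus>\<^bsub>S\<^esub> b t (\<alpha> s u))"
proof (rule P.lambda_map_eqI)
  note cl = assms alpha_closed b_closed
  show "(t, s) \<in> carrier P" "(\<alpha> s u, lambda_map S s r \<ominus>\<^bsub>S\<^esub> b t (\<alpha> s u)) \<in> carrier P"
    using cl by (simp_all add: carrier_P lambda_map_def)
  have "lambda_map S s r \<ominus>\<^bsub>S\<^esub> b t (\<alpha> s u) \<oplus>\<^bsub>S\<^esub> s \<oplus>\<^bsub>S\<^esub> b (\<alpha> s u) t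
      = s \<otimes>\<^bsub>S\<^esub> r \<oplus>\<^bsub>S\<^esub> (\<ominus>\<^bsub>S\<^esub> s \<oplus>\<^bsub>S\<^esub> s) \<oplus>\<^bsub>S\<^esub> (\<ominus>\<^bsub>S\<^esub> b t (\<alpha> s u) \<oplus>\<^bsub>S\<^esub> b t (\<alpha> s u))"
    using cl cocycle_sym[of t "\<alpha> s u"]
    by (simp add: lambda_map_def a_minus_def S.a_ac del: S.r_neg S.l_neg)
  also have "\<dots> = s \<otimes>\<^bsub>S\<^esub> r"
    using cl by (simp add: S.l_neg)
  finally show "(t, s) \<otimes>\<^bsub>P\<^esub> (u, r) = (\<alpha> s u, lambda_map S s r \<ominus>\<^bsub>S\<^esub> b t (\<alpha> s u)) \<oplus>\<^bsub>P\<^esub> (t, s)"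
    using cl by (simp add: mult_P add_P T.a_comm)
qed

lemma displacements_subset: "displacements \<subseteq> carrier T"
  using alpha_closed by auto

lemma W_subgroup: "subgroup W (add_monoid T)"
  using T.add.generate_is_subgroup displacements_subset by simp

lemma W_closed: "w \<in> W \<Longrightarrow> w \<in> carrier T"
  and W_zero: "\<zero>\<^bsub>T\<^esub> \<in> W"
  and W_add: "\<lbrakk> v \<in> W; w \<in> W \<rbrakk> \<Longrightarrow> v \<oplus>\<^bsub>T\<^esub> w \<in> W"
  and W_neg: "w \<in> W \<Longrightarrow> \<ominus>\<^bsub>T\<^esub> w \<in> W"
  using W_subgroup subgroup.mem_carrier[OF W_subgroup] subgroup.one_closed[OF W_subgroup]
    subgroup.m_closed[OF W_subgroup] subgroup.m_inv_closed[OF W_subgroup]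
  by (simp_all add: a_inv_def)

lemma displacement_in_W: "\<lbrakk> s \<in> carrier S; t \<in> carrier T \<rbrakk> \<Longrightarrow> \<alpha> s t \<ominus>\<^bsub>T\<^esub> t \<in> W"
  by (auto intro: generate.incl)

text \<open>The point \<open>\<alpha>\<^sub>s(w)\<close> differs from \<open>w\<close> by a displacement.\<close>

lemma W_alpha:
  assumes "s \<in> carrier S" "w \<in> W"
  shows "\<alpha> s w \<in> W"
proof -
  have "(\<alpha> s w \<ominus>\<^bsub>T\<^esub> w) \<oplus>\<^bsub>T\<^esub> w = \<alpha> s w"
    using assms W_closed alpha_closed by (simp add: a_minus_def T.a_assoc T.l_neg)
  then show ?thesis
    using W_add[OF displacement_in_W[of s w] assms(2)] assms W_closed by simp
qed

text \<open>The kernel of the projection of \<open>P\<close> onto the trivial brace \<open>T/W\<close>.\<close>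

lemma brace_ideal_displacement_times: "brace_ideal (W \<times> carrier S) P"
  unfolding brace_ideal_def
proof (intro conjI ballI)
  have sub: "subgroup (W \<times> carrier S) P"
    by (rule P.subgroupI)
      (auto simp: carrier_P mult_P inv_P W_closed W_add W_neg W_alpha intro: generate.one)
  have "x \<otimes>\<^bsub>P\<^esub> n \<otimes>\<^bsub>P\<^esub> inv\<^bsub>P\<^esub> x \<in> W \<times> carrier S"
    if x: "x \<in> carrier P" and n: "n \<in> W \<times> carrier S" for x n
  proof -
    obtain t s w r where xn: "x = (t, s)" "n = (w, r)"
      and cl: "t \<in> carrier T" "s \<in> carrier S" "w \<in> W" "r \<in> carrier S"
      using x n by (auto simp: carrier_P)
    note cl' = cl W_closed[OF cl(3)] alpha_closed
    let ?q = "s \<otimes>\<^bsub>S\<^esub> r \<otimes>\<^bsub>S\<^esub> inv\<^bsub>S\<^esub> s"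
    \<comment> \<open>Modulo \<open>W\<close> the first component is \<open>t + w - t\<close>; the error is a single displacement of \<open>t\<close>.\<close>
    have "x \<otimes>\<^bsub>P\<^esub> n \<otimes>\<^bsub>P\<^esub> inv\<^bsub>P\<^esub> x = (t \<oplus>\<^bsub>T\<^esub> \<alpha> s w \<oplus>\<^bsub>T\<^esub> \<ominus>\<^bsub>T\<^esub> \<alpha> ?q t, ?q)"
      using cl' by (simp add: xn mult_P inv_P alpha_neg alpha_comp)
    also have "t \<oplus>\<^bsub>T\<^esub> \<alpha> s w \<oplus>\<^bsub>T\<^esub> \<ominus>\<^bsub>T\<^esub> \<alpha> ?q t = \<alpha> s w \<oplus>\<^bsub>T\<^esub> \<ominus>\<^bsub>T\<^esub> (\<alpha> ?q t \<ominus>\<^bsub>T\<^esub> t)"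
      using cl' by (simp add: a_minus_def T.minus_add T.a_ac)
    also have "(\<dots>, ?q) \<in> W \<times> carrier S"
      using cl' displacement_in_W[of ?q t] by (simp add: W_add W_neg W_alpha)
    finally show ?thesis .
  qed
  with sub show "W \<times> carrier S \<lhd> P"
    by (simp add: P.normal_inv_iff)
next
  fix x y
  assume "x \<in> carrier P" "y \<in> W \<times> carrier S"
  then obtain t s w r where xy: "x = (t, s)" "y = (w, r)"
    and cl: "t \<in> carrier T" "s \<in> carrier S" "w \<in> W" "r \<in> carrier S"
    by (auto simp: carrier_P)
  have "lambda_map S s r \<in> carrier S" "b t (\<alpha> s w) \<in> carrier S"
    using cl W_closed alpha_closed b_closed by (simp_all add: lambda_map_def)
  then show "lambda_map P x y \<in> W \<times> carrier S"
    using cl by (simp add: xy lambda_map_product W_closed W_alpha)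
qed

text \<open>The map \<open>s \<mapsto> (0, s)\<close> embeds \<open>S\<close> in \<open>P\<close> as a left brace, because \<open>b(0, 0) = 0\<close>.\<close>

lemma brace_ideal_fibre:
  assumes "brace_ideal N P"
  shows "brace_ideal {s \<in> carrier S. (\<zero>\<^bsub>T\<^esub>, s) \<in> N} S" (is "brace_ideal ?J S")
proof -
  have N: "N \<lhd> P" and lam: "\<And>x y. \<lbrakk> x \<in> carrier P; y \<in> N \<rbrakk> \<Longrightarrow> lambda_map P x y \<in> N"
    using assms by (auto simp: brace_ideal_def)
  have sub: "subgroup N P"
    using N by (rule normal_imp_subgroup)
  have mult: "(\<zero>\<^bsub>T\<^esub>, s) \<otimes>\<^bsub>P\<^esub> (\<zero>\<^bsub>T\<^esub>, r) = (\<zero>\<^bsub>T\<^esub>, s \<otimes>\<^bsub>S\<^esub> r)" if "s \<in> carrier S" for s r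
    using that by (simp add: mult_P alpha_zero)
  have inv: "inv\<^bsub>P\<^esub> (\<zero>\<^bsub>T\<^esub>, s) = (\<zero>\<^bsub>T\<^esub>, inv\<^bsub>S\<^esub> s)" if "s \<in> carrier S" for s
    using that by (simp add: inv_P alpha_zero)
  have "subgroup ?J S"
  proof (rule S.subgroupI)
    show "?J \<noteq> {}"
      using subgroup.one_closed[OF sub] by (auto simp: one_P)
    show "inv\<^bsub>S\<^esub> s \<in> ?J" if "s \<in> ?J" for s
      using that subgroup.m_inv_closed[OF sub] inv by force
    show "s \<otimes>\<^bsub>S\<^esub> r \<in> ?J" if "s \<in> ?J" "r \<in> ?J" for s r
      using that subgroup.m_closed[OF sub] mult by force
  qed auto
  moreover have "s \<otimes>\<^bsub>S\<^esub> r \<otimes>\<^bsub>S\<^esub> inv\<^bsub>S\<^esub> s \<in> ?J" if "s \<in> carrier S" "r \<in> ?J" for s r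
    using that normal.inv_op_closed2[OF N, of "(\<zero>\<^bsub>T\<^esub>, s)" "(\<zero>\<^bsub>T\<^esub>, r)"]
    by (simp add: mult inv carrier_P)
  moreover have "lambda_map S s r \<in> ?J" if "s \<in> carrier S" "r \<in> ?J" for s r
  proof -
    have zero_neg: "\<ominus>\<^bsub>S\<^esub> \<zero>\<^bsub>S\<^esub> = \<zero>\<^bsub>S\<^esub>"
      by (simp add: S.minus_equality)
    have "lambda_map S s r \<in> carrier S"
      using that by (simp add: lambda_map_def)
    then show ?thesis
      using that lam[of "(\<zero>\<^bsub>T\<^esub>, s)" "(\<zero>\<^bsub>T\<^esub>, r)"]
      by (simp add: carrier_P lambda_map_product alpha_zero b_zero_left a_minus_def zero_neg)
  qed
  ultimately show ?thesis
    by (simp add: brace_ideal_def S.normal_inv_iff)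
qed

text \<open>
  The maps \<open>\<lambda>\<^bsub>(t', 0)\<^esub>\<close> fix the first component and shift the second by values of \<open>b\<close>, so a
  non-degenerate \<open>b\<close> yields two different elements of the ideal over the same point of \<open>T\<close>.
\<close>

lemma fibre_nonzero:
  assumes N: "brace_ideal N P" "N \<noteq> {\<zero>\<^bsub>P\<^esub>}"
    and nondeg: "\<forall>t \<in> carrier T - {\<zero>\<^bsub>T\<^esub>}. \<exists>t' \<in> carrier T. b t t' \<noteq> \<zero>\<^bsub>S\<^esub>"
  obtains s where "s \<in> carrier S" "s \<noteq> \<zero>\<^bsub>S\<^esub>" "(\<zero>\<^bsub>T\<^esub>, s) \<in> N"
proof -
  have sub: "subgroup N P"
    using N(1) by (simp add: brace_ideal_def normal_imp_subgroup)
  have "\<zero>\<^bsub>P\<^esub> \<in> N"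
    using subgroup.one_closed[OF sub] by (simp add: P.one_eq_zero)
  then obtain t s where ts: "(t, s) \<in> N" "(t, s) \<noteq> \<zero>\<^bsub>P\<^esub>"
    using N(2) by auto
  then have cl: "t \<in> carrier T" "s \<in> carrier S"
    using brace_ideal_subset[OF N(1)] by (auto simp: carrier_P)
  show ?thesis
  proof (cases "t = \<zero>\<^bsub>T\<^esub>")
    case True
    then show ?thesis
      using ts cl that[of s] by (auto simp: zero_P)
  next
    case False
    then obtain u where u: "u \<in> carrier T" "b t u \<noteq> \<zero>\<^bsub>S\<^esub>"
      using nondeg cl by blast
    have b: "b u t \<in> carrier S" "b u t \<noteq> \<zero>\<^bsub>S\<^esub>"
      using u cl cocycle_sym b_closed by auto
    let ?r = "s \<ominus>\<^bsub>S\<^esub> b u t" and ?q = "inv\<^bsub>S\<^esub> s \<otimes>\<^bsub>S\<^esub> (s \<ominus>\<^bsub>S\<^esub> b u t)"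
    have "lambda_map S \<one>\<^bsub>S\<^esub> s = s"
      using cl by (simp add: lambda_map_def S.one_eq_zero[symmetric])
        (simp add: S.one_eq_zero a_minus_def)
    then have "lambda_map P (u, \<one>\<^bsub>S\<^esub>) (t, s) = (t, ?r)"
      using u cl by (simp add: lambda_map_product alpha_one)
    then have "(t, ?r) \<in> N"
      using N(1) ts(1) u(1) unfolding brace_ideal_def carrier_P
      by (metis SigmaI S.one_closed)
    then have "inv\<^bsub>P\<^esub> (t, s) \<otimes>\<^bsub>P\<^esub> (t, ?r) \<in> N"
      using sub ts(1) by (simp add: subgroup.m_closed subgroup.m_inv_closed)
    then have "(\<zero>\<^bsub>T\<^esub>, ?q) \<in> N"
      using cl by (simp add: inv_P mult_P alpha_closed T.l_neg)
    moreover have "?q \<noteq> \<zero>\<^bsub>S\<^esub>"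
    proof
      assume "?q = \<zero>\<^bsub>S\<^esub>"
      then have "s \<otimes>\<^bsub>S\<^esub> ?q = s"
        using cl by (simp add: S.one_eq_zero[symmetric])
      then have "?r = s"
        using cl b by (simp add: S.m_assoc[symmetric])
      then show False
        using cl b by (simp add: a_minus_def)
    qed
    ultimately show ?thesis
      using cl b that[of ?q] by simp
  qed
qed

text \<open>The displacement \<open>\<alpha>\<^sub>s(t) - t\<close> is the commutator of \<open>-t\<close> and \<open>s\<close> in the semidirect product.\<close>

lemma displacement_in_normal:
  assumes N: "N \<lhd> P" and S: "{\<zero>\<^bsub>T\<^esub>} \<times> carrier S \<subseteq> N" and w: "w \<in> W"
  shows "(w, \<one>\<^bsub>S\<^esub>) \<in> N"
proof -
  have sub: "subgroup N P"
    using N by (rule normal_imp_subgroup)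
  have displacement: "(h, \<one>\<^bsub>S\<^esub>) \<in> N" if disp: "h \<in> displacements" for h
  proof -
    obtain s t where h: "h = \<alpha> s t \<ominus>\<^bsub>T\<^esub> t" and cl: "s \<in> carrier S" "t \<in> carrier T"
      using disp by auto
    let ?u = "(\<ominus>\<^bsub>T\<^esub> t, \<one>\<^bsub>S\<^esub>)"
    have "?u \<otimes>\<^bsub>P\<^esub> (\<zero>\<^bsub>T\<^esub>, s) \<otimes>\<^bsub>P\<^esub> inv\<^bsub>P\<^esub> ?u \<in> N"
      using normal.inv_op_closed2[OF N] S cl by (simp add: carrier_P subset_eq)
    moreover have "(\<zero>\<^bsub>T\<^esub>, inv\<^bsub>S\<^esub> s) \<in> N"
      using S cl by auto
    ultimately have "?u \<otimes>\<^bsub>P\<^esub> (\<zero>\<^bsub>T\<^esub>, s) \<otimes>\<^bsub>P\<^esub> inv\<^bsub>P\<^esub> ?u \<otimes>\<^bsub>P\<^esub> (\<zero>\<^bsub>T\<^esub>, inv\<^bsub>S\<^esub> s) \<in> N"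
      by (rule subgroup.m_closed[OF sub])
    then show ?thesis
      using cl by (simp add: h mult_P inv_P alpha_closed alpha_zero alpha_one a_minus_def T.a_comm)
  qed
  show ?thesis
    using w
  proof (induction rule: generate.induct)
    case one
    then show ?case
      using S by auto
  next
    case (incl h)
    then show ?case
      by (rule displacement)
  next
    case (inv h)
    then have "h \<in> carrier T"
      using displacements_subset by blast
    then show ?case
      using subgroup.m_inv_closed[OF sub displacement[OF inv]]
      by (simp add: inv_P alpha_one a_inv_def)
  next
    case (eng v w)
    then have "v \<in> carrier T" "w \<in> carrier T"
      using W_closed by auto
    then show ?case
      using subgroup.m_closed[OF sub eng.IH] by (simp add: mult_P alpha_one)
  qed
qed

text \<open>Every \<open>(t, s)\<close> is the product of \<open>(t, 0)\<close> and \<open>(0, s)\<close>.\<close>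

lemma normal_eq_carrier:
  assumes N: "N \<lhd> P" and S: "{\<zero>\<^bsub>T\<^esub>} \<times> carrier S \<subseteq> N" and W: "W = carrier T"
  shows "N = carrier P"
proof
  have sub: "subgroup N P"
    using N by (rule normal_imp_subgroup)
  then show "N \<subseteq> carrier P"
    by (rule subgroup.subset)
  show "carrier P \<subseteq> N"
  proof
    fix x
    assume "x \<in> carrier P"
    then obtain t s where x: "x = (t, s)" and cl: "t \<in> carrier T" "s \<in> carrier S"
      by (auto simp: carrier_P)
    have "(t, \<one>\<^bsub>S\<^esub>) \<in> N" "(\<zero>\<^bsub>T\<^esub>, s) \<in> N"
      using displacement_in_normal[OF N S, of t] S W cl by auto
    then have "(t, \<one>\<^bsub>S\<^esub>) \<otimes>\<^bsub>P\<^esub> (\<zero>\<^bsub>T\<^esub>, s) \<in> N"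
      by (rule subgroup.m_closed[OF sub])
    then show "x \<in> N"
      using cl by (simp add: x mult_P alpha_one)
  qed
qed

lemma simple_imp_displacement_eq:
  assumes "simple_left_brace P" and "carrier S \<noteq> {\<zero>\<^bsub>S\<^esub>}"
  shows "W = carrier T"
proof -
  obtain s where s: "s \<in> carrier S" "s \<noteq> \<zero>\<^bsub>S\<^esub>"
    using assms(2) S.zero_closed by blast
  then have "W \<times> carrier S \<noteq> {\<zero>\<^bsub>P\<^esub>}"
    using W_zero by (auto simp: zero_P)
  then have "W \<times> carrier S = carrier T \<times> carrier S"
    using assms(1) brace_ideal_displacement_times
    unfolding simple_left_brace_def carrier_P by blast
  then show ?thesis
    using s by blast
qed

lemma displacement_eq_imp_simple:
  assumes S: "simple_left_brace S" and W: "W = carrier T"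
    and nondeg: "\<forall>t \<in> carrier T - {\<zero>\<^bsub>T\<^esub>}. \<exists>t' \<in> carrier T. b t t' \<noteq> \<zero>\<^bsub>S\<^esub>"
  shows "simple_left_brace P"
  unfolding simple_left_brace_def
proof (intro conjI allI impI)
  show "left_brace P" ..
  obtain s where "s \<in> carrier S" "s \<noteq> \<zero>\<^bsub>S\<^esub>"
    using S S.zero_closed unfolding simple_left_brace_def by blast
  then have "(\<zero>\<^bsub>T\<^esub>, s) \<in> carrier P" "(\<zero>\<^bsub>T\<^esub>, s) \<noteq> \<zero>\<^bsub>P\<^esub>"
    by (simp_all add: carrier_P zero_P)
  then show "carrier P \<noteq> {\<zero>\<^bsub>P\<^esub>}"
    by blast
next
  fix N
  assume N: "brace_ideal N P"
  show "N = {\<zero>\<^bsub>P\<^esub>} \<or> N = carrier P"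
  proof (cases "N = {\<zero>\<^bsub>P\<^esub>}")
    case False
    then obtain s where s: "s \<in> carrier S" "s \<noteq> \<zero>\<^bsub>S\<^esub>" "(\<zero>\<^bsub>T\<^esub>, s) \<in> N"
      using fibre_nonzero[OF N _ nondeg] by blast
    then have "{s \<in> carrier S. (\<zero>\<^bsub>T\<^esub>, s) \<in> N} \<noteq> {\<zero>\<^bsub>S\<^esub>}"
      by blast
    then have "{s \<in> carrier S. (\<zero>\<^bsub>T\<^esub>, s) \<in> N} = carrier S"
      using S brace_ideal_fibre[OF N] unfolding simple_left_brace_def by blast
    then have "{\<zero>\<^bsub>T\<^esub>} \<times> carrier S \<subseteq> N"
      by blast
    then show ?thesis
      using normal_eq_carrier N W by (simp add: brace_ideal_def)
  qed simp
qed

end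

theorem theorem3p3:
  fixes T :: "('a, 'm) ring_scheme" and S :: "('b, 'n) ring_scheme"
    and b :: "'a \<Rightarrow> 'a \<Rightarrow> 'b" and \<alpha> :: "'b \<Rightarrow> 'a \<Rightarrow> 'a"
  assumes "simple_left_brace S" and "\<not> trivial_brace S"
    and "trivial_brace T"
    and "asymmetric_product_data T S b \<alpha>"
    and "\<forall>t \<in> carrier T - {\<zero>\<^bsub>T\<^esub>}. \<exists>t' \<in> carrier T. b t t' \<noteq> \<zero>\<^bsub>S\<^esub>"
  shows "simple_left_brace (asymmetric_product T S b \<alpha>) \<longleftrightarrow>
    generate (add_monoid T) (\<Union>s \<in> carrier S. {\<alpha> s t \<ominus>\<^bsub>T\<^esub> t | t. t \<in> carrier T}) = carrier T"
proof -
  interpret asymmetric_product_by_trivial T S b \<alpha>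
    using assms(3,4)
    by (simp add: asymmetric_product_by_trivial_def asymmetric_product_by_trivial_axioms_def
        trivial_brace_def)
  show ?thesis
    using simple_imp_displacement_eq displacement_eq_imp_simple[OF assms(1) _ assms(5)] assms(1)
    by (auto simp only: simple_left_brace_def[of S])
qed

end
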